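(* Let $M$ be either of the adjacency, Laplacian, distance or distance Laplacian matrices. Two graphs $G$ and $H$ with $n$ vertices are $M$-coinvariant if and only if they are $M^{\mathbb{Z}}$-codeterminantal.
   Context: Graphs are simple, finite and connected. For a graph $G$ with $n$ vertices: $A(G)$ is the adjacency matrix; $L(G)=\deg(G)-A(G)$ is the Laplacian, where $\deg(G)$ is the diagonal matrix of vertex degrees; $D(G)$ is the distance matrix (entry $(u,v)$ is the graph distance between $u$ and $v$); the distance Laplacian is $F(G)=T(G)-D(G)$, where $T(G)$ is the diagonal matrix of transmissions, the transmission of a vertex being the sum of its distances to all other vertices. For $M\in\{A,L,D,F\}$, $I_k^{\mathbb{Z}}(M(G))\subseteq\mathbb{Z}$ is the ideal of $\mathbb{Z}$ generated by all $k\times k$ minors of the integer matrix $M(G)$. $G$ and $H$ are $M^{\mathbb{Z}}$-codeterminantal if $I_k^{\mathbb{Z}}(M(G))=I_k^{\mathbb{Z}}(M(H))$ for each $k\in\{1,\dots,n\}$. $G$ and $H$ are $M$-coinvariant if the Smith normal forms, computed over $\mathbb{Z}$ (with nonnegative diagonal entries), of $M(G)$ and $M(H)$ are the same. *)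

theory Defs
  imports
    "HOL-Algebra.IntRing"
    "Graph_Theory.Arc_Walk"
    "Graph_Theory.Digraph_Component"
    "Jordan_Normal_Form.Determinant"
    "Jordan_Normal_Form.DL_Submatrix"
begin

text \<open>
  A finite simple undirected graph is a symmetric digraph without loops and parallel arcs
  (locale \<open>graph\<close>): each undirected edge is a pair of opposite arcs, so the degree of a
  vertex is its out-degree. Matrices are written with respect to an enumeration \<open>vs\<close>
  of the vertices, i.e. a list with \<open>distinct vs\<close> and \<open>set vs = verts G\<close>.
\<close>

definition enumerates :: "'a list \<Rightarrow> ('a, 'b) pre_digraph \<Rightarrow> bool" where
  "enumerates vs G \<longleftrightarrow> distinct vs \<and> set vs = verts G"

definition graph_dist :: "('a, 'b) pre_digraph \<Rightarrow> 'a \<Rightarrow> 'a \<Rightarrow> nat" where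
  "graph_dist G u v = (LEAST k. \<exists>p. pre_digraph.awalk G u p v \<and> length p = k)"

definition transmission :: "('a, 'b) pre_digraph \<Rightarrow> 'a \<Rightarrow> nat" where
  "transmission G v = (\<Sum>u\<in>verts G. graph_dist G v u)"

definition diag_on :: "'a list \<Rightarrow> ('a \<Rightarrow> nat) \<Rightarrow> int mat" where
  "diag_on vs f = mat (length vs) (length vs) (\<lambda>(i, j). if i = j then int (f (vs ! i)) else 0)"

definition adjacency_mat :: "('a, 'b) pre_digraph \<Rightarrow> 'a list \<Rightarrow> int mat" where
  "adjacency_mat G vs =
     mat (length vs) (length vs) (\<lambda>(i, j). if vs ! i \<rightarrow>\<^bsub>G\<^esub> vs ! j then 1 else 0)"

definition laplacian_mat :: "('a, 'b) pre_digraph \<Rightarrow> 'a list \<Rightarrow> int mat" where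
  "laplacian_mat G vs = diag_on vs (out_degree G) - adjacency_mat G vs"

definition distance_mat :: "('a, 'b) pre_digraph \<Rightarrow> 'a list \<Rightarrow> int mat" where
  "distance_mat G vs =
     mat (length vs) (length vs) (\<lambda>(i, j). int (graph_dist G (vs ! i) (vs ! j)))"

definition distance_laplacian_mat :: "('a, 'b) pre_digraph \<Rightarrow> 'a list \<Rightarrow> int mat" where
  "distance_laplacian_mat G vs = diag_on vs (transmission G) - distance_mat G vs"

text \<open>
  A datatype rather than a set of functions, so that one \<open>M\<close> applies to graphs over
  different vertex and arc types.
\<close>

datatype matrix_kind = Adjacency | Laplacian | Distance | Distance_Laplacian

fun graph_mat :: "matrix_kind \<Rightarrow> ('a, 'b) pre_digraph \<Rightarrow> 'a list \<Rightarrow> int mat" where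
  "graph_mat Adjacency = adjacency_mat"
| "graph_mat Laplacian = laplacian_mat"
| "graph_mat Distance = distance_mat"
| "graph_mat Distance_Laplacian = distance_laplacian_mat"

definition minors :: "nat \<Rightarrow> int mat \<Rightarrow> int set" where
  "minors k A = {det (submatrix A I J) | I J.
     I \<subseteq> {..<dim_row A} \<and> J \<subseteq> {..<dim_col A} \<and> card I = k \<and> card J = k}"

definition determinantal_ideal :: "nat \<Rightarrow> int mat \<Rightarrow> int set" where
  "determinantal_ideal k A = Idl\<^bsub>\<Z>\<^esub> (minors k A)"

text \<open>
  In the following, invertibility is over the integers. The divisibility condition forces the
  zero diagonal entries to come last, since \<open>0\<close> divides only \<open>0\<close>.
\<close>

definition is_smith_normal_form :: "int mat \<Rightarrow> int mat \<Rightarrow> bool" where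
  "is_smith_normal_form A S \<longleftrightarrow>
     S \<in> carrier_mat (dim_row A) (dim_col A) \<and>
     diagonal_mat S \<and>
     (\<forall>i < min (dim_row S) (dim_col S). 0 \<le> S $$ (i, i)) \<and>
     (\<forall>i. Suc i < min (dim_row S) (dim_col S) \<longrightarrow> S $$ (i, i) dvd S $$ (Suc i, Suc i)) \<and>
     (\<exists>P \<in> carrier_mat (dim_row A) (dim_row A). \<exists>Q \<in> carrier_mat (dim_col A) (dim_col A).
        invertible_mat P \<and> invertible_mat Q \<and> S = P * A * Q)"

definition smith_normal_form :: "int mat \<Rightarrow> int mat" where
  "smith_normal_form A = (THE S. is_smith_normal_form A S)"

definition coinvariant ::
  "matrix_kind \<Rightarrow> ('a, 'b) pre_digraph \<Rightarrow> 'a list \<Rightarrow> ('c, 'd) pre_digraph \<Rightarrow> 'c list \<Rightarrow> bool" where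
  "coinvariant M G vs H ws \<longleftrightarrow>
     smith_normal_form (graph_mat M G vs) = smith_normal_form (graph_mat M H ws)"

definition codeterminantal ::
  "matrix_kind \<Rightarrow> ('a, 'b) pre_digraph \<Rightarrow> 'a list \<Rightarrow> ('c, 'd) pre_digraph \<Rightarrow> 'c list \<Rightarrow> bool" where
  "codeterminantal M G vs H ws \<longleftrightarrow>
     (\<forall>k \<in> {1..card (verts G)}.
        determinantal_ideal k (graph_mat M G vs) = determinantal_ideal k (graph_mat M H ws))"

end

theory Submission
  imports Defs
begin

text \<open>
  The matrices of graphs with the same number of vertices are integer matrices of the same size. So
  the theorem is an instance of the fact that, among integer matrices \<open>A\<close> and \<open>B\<close> of size \<open>m\<close> by
  \<open>n\<close>, the Smith normal form and the determinantal ideals determine each other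
  (\<open>smith_normal_form_eq_iff_determinantal_ideal_eq\<close>).

  An ideal of \<open>\<int>\<close> generated by a set is determined by the gcd of that set
  (\<open>Idl_int_eq_iff_Gcd_eq\<close>), so the determinantal ideals carry the same information as the
  determinantal divisors, the gcds of the minors of each order. Multiplying by a matrix writes each
  minor of the product as an integer combination of minors of the factor
  (\<open>det_selection_mat_mult\<close>), so the determinantal divisors do not change under multiplication
  by invertible integer matrices on both sides (\<open>Gcd_minors_unimodular_equiv\<close>). In particular
  they can be read off from a Smith normal form with diagonal \<open>d 0, d 1, \<dots>\<close>, where the
  divisor of order \<open>k\<close> is \<open>d 0 * \<dots> * d (k - 1)\<close>
  (\<open>Gcd_minors_smith_normal_form\<close>).

  Conversely these products determine the \<open>d i\<close>: as long as the products are nonzero they are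
  successive quotients, and from the first zero product on all \<open>d i\<close> vanish by divisibility
  (\<open>divisor_chain_eq_if_prods_eq\<close>). Hence two normal forms agree exactly if the determinantal
  divisors agree (\<open>smith_normal_forms_eq_iff\<close>). Taken with \<open>A = B\<close> this gives uniqueness of
  the Smith normal form; together with its existence (\<open>smith_normal_form_exists\<close>) it justifies
  the definite description that defines \<^const>\<open>smith_normal_form\<close>.
\<close>

section \<open>Unimodular equivalence\<close>

definition unimodular_equiv :: "int mat \<Rightarrow> int mat \<Rightarrow> bool" where
  "unimodular_equiv A B \<longleftrightarrow>
     (\<exists>P \<in> carrier_mat (dim_row A) (dim_row A). \<exists>Q \<in> carrier_mat (dim_col A) (dim_col A).
        invertible_mat P \<and> invertible_mat Q \<and> B = P * A * Q)"

text \<open>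
  The definition of invertibility leaves the size of the inverse open; comparing the dimensions of
  both products forces it to be that of the matrix.
\<close>

lemma invertible_mat_iff:
  fixes P :: "'a :: semiring_1 mat"
  assumes "P \<in> carrier_mat n n"
  shows "invertible_mat P \<longleftrightarrow> (\<exists>P' \<in> carrier_mat n n. P * P' = 1\<^sub>m n \<and> P' * P = 1\<^sub>m n)"
proof
  assume "invertible_mat P"
  then obtain P' where P': "P * P' = 1\<^sub>m n" "P' * P = 1\<^sub>m (dim_row P')"
    using assms unfolding invertible_mat_def inverts_mat_def by auto
  have "dim_col P' = n" using arg_cong[OF P'(1), of dim_col] by simp
  moreover have "dim_row P' = n" using arg_cong[OF P'(2), of dim_col] assms by simp
  ultimately show "\<exists>P' \<in> carrier_mat n n. P * P' = 1\<^sub>m n \<and> P' * P = 1\<^sub>m n"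
    using P' by (metis carrier_matI)
next
  assume "\<exists>P' \<in> carrier_mat n n. P * P' = 1\<^sub>m n \<and> P' * P = 1\<^sub>m n"
  then show "invertible_mat P"
    using assms unfolding invertible_mat_def inverts_mat_def by auto
qed

lemma invertible_mat_one: "invertible_mat (1\<^sub>m n :: 'a :: semiring_1 mat)"
  by (subst invertible_mat_iff) (auto intro!: bexI[of _ "1\<^sub>m n"])

lemma invertible_mat_mult:
  fixes P :: "'a :: semiring_1 mat"
  assumes P: "P \<in> carrier_mat n n" "invertible_mat P" and Q: "Q \<in> carrier_mat n n" "invertible_mat Q"
  shows "invertible_mat (P * Q)"
proof -
  obtain P' where P': "P' \<in> carrier_mat n n" "P * P' = 1\<^sub>m n" "P' * P = 1\<^sub>m n"
    using P invertible_mat_iff by blast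
  obtain Q' where Q': "Q' \<in> carrier_mat n n" "Q * Q' = 1\<^sub>m n" "Q' * Q = 1\<^sub>m n"
    using Q invertible_mat_iff by blast
  have "(P * Q) * (Q' * P') = P * ((Q * Q') * P')"
    using P(1) Q(1) P'(1) Q'(1) by (simp add: assoc_mult_mat[of _ n n _ n _ n])
  moreover have "(Q' * P') * (P * Q) = Q' * ((P' * P) * Q)"
    using P(1) Q(1) P'(1) Q'(1) by (simp add: assoc_mult_mat[of _ n n _ n _ n])
  moreover have "P * Q \<in> carrier_mat n n" "Q' * P' \<in> carrier_mat n n" using P Q P' Q' by auto
  moreover have "P * ((Q * Q') * P') = 1\<^sub>m n" "Q' * ((P' * P) * Q) = 1\<^sub>m n"
    using P Q P' Q' by simp_all
  ultimately show ?thesis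
    by (subst invertible_mat_iff[of _ n]) (auto simp del: assoc_mult_mat)
qed

lemma invertible_mat_transpose:
  fixes P :: "'a :: comm_semiring_1 mat"
  assumes P: "P \<in> carrier_mat n n" "invertible_mat P"
  shows "invertible_mat P\<^sup>T"
proof -
  obtain P' where P': "P' \<in> carrier_mat n n" "P * P' = 1\<^sub>m n" "P' * P = 1\<^sub>m n"
    using P invertible_mat_iff by blast
  have "P\<^sup>T * P'\<^sup>T = (P' * P)\<^sup>T" "P'\<^sup>T * P\<^sup>T = (P * P')\<^sup>T"
    using P(1) P'(1) by (metis transpose_mult)+
  then have "P\<^sup>T * P'\<^sup>T = 1\<^sub>m n" "P'\<^sup>T * P\<^sup>T = 1\<^sub>m n" unfolding P'(2,3) by simp_all
  then show ?thesis
    using P P' by (subst invertible_mat_iff[of _ n]) auto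
qed

lemma unimodular_equivI:
  assumes "A \<in> carrier_mat m n" "P \<in> carrier_mat m m" "invertible_mat P"
    "Q \<in> carrier_mat n n" "invertible_mat Q"
  shows "unimodular_equiv A (P * A * Q)"
  using assms unfolding unimodular_equiv_def by auto

lemma unimodular_equivE:
  assumes "unimodular_equiv A B" "A \<in> carrier_mat m n"
  obtains P Q where "P \<in> carrier_mat m m" "invertible_mat P"
    "Q \<in> carrier_mat n n" "invertible_mat Q" "B = P * A * Q"
  using assms unfolding unimodular_equiv_def by auto

lemma unimodular_equiv_carrier:
  assumes "unimodular_equiv A B" "A \<in> carrier_mat m n"
  shows "B \<in> carrier_mat m n"
  using assms by (auto elim!: unimodular_equivE)

lemma unimodular_equiv_left:
  assumes A: "A \<in> carrier_mat m n" and P: "P \<in> carrier_mat m m" "invertible_mat P"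
  shows "unimodular_equiv A (P * A)"
proof -
  have "P * A * 1\<^sub>m n = P * A" using A P by (intro right_mult_one_mat) auto
  then show ?thesis
    using unimodular_equivI[OF A P one_carrier_mat invertible_mat_one] by metis
qed

lemma unimodular_equiv_refl: "unimodular_equiv A A"
proof -
  have "A \<in> carrier_mat (dim_row A) (dim_col A)" by simp
  from unimodular_equiv_left[OF this one_carrier_mat invertible_mat_one] left_mult_one_mat[OF this]
  show ?thesis by metis
qed

lemma unimodular_equiv_trans:
  assumes AB: "unimodular_equiv A B" and BC: "unimodular_equiv B C"
  shows "unimodular_equiv A C"
proof -
  define m n where "m = dim_row A" and "n = dim_col A"
  have A: "A \<in> carrier_mat m n" unfolding m_def n_def by auto
  obtain P Q where PQ: "P \<in> carrier_mat m m" "invertible_mat P"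
    "Q \<in> carrier_mat n n" "invertible_mat Q" "B = P * A * Q"
    using AB A by (rule unimodular_equivE)
  obtain R S where RS: "R \<in> carrier_mat m m" "invertible_mat R"
    "S \<in> carrier_mat n n" "invertible_mat S" "C = R * B * S"
    using BC unimodular_equiv_carrier[OF AB A] by (rule unimodular_equivE)
  have "C = (R * P) * A * (Q * S)"
    using A PQ RS by (simp add: assoc_mult_mat[of _ m m _ m _ n] assoc_mult_mat[of _ m m _ n _ n]
        assoc_mult_mat[of _ m n _ n _ n])
  then show ?thesis
    using unimodular_equivI[OF A, of "R * P" "Q * S"] PQ RS invertible_mat_mult by auto
qed

lemma unimodular_equiv_sym:
  assumes AB: "unimodular_equiv A B"
  shows "unimodular_equiv B A"
proof -
  define m n where "m = dim_row A" and "n = dim_col A"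
  have A: "A \<in> carrier_mat m n" unfolding m_def n_def by auto
  obtain P Q where PQ: "P \<in> carrier_mat m m" "invertible_mat P"
    "Q \<in> carrier_mat n n" "invertible_mat Q" "B = P * A * Q"
    using AB A by (rule unimodular_equivE)
  obtain P' where P': "P' \<in> carrier_mat m m" "P * P' = 1\<^sub>m m" "P' * P = 1\<^sub>m m"
    using PQ invertible_mat_iff by blast
  obtain Q' where Q': "Q' \<in> carrier_mat n n" "Q * Q' = 1\<^sub>m n" "Q' * Q = 1\<^sub>m n"
    using PQ invertible_mat_iff by blast
  have "P' * B * Q' = (P' * P) * A * (Q * Q')"
    using A PQ(1,3,5) P'(1) Q'(1)
    by (simp add: assoc_mult_mat[of _ m m _ m _ n] assoc_mult_mat[of _ m m _ n _ n]
        assoc_mult_mat[of _ m n _ n _ n])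
  then have "A = P' * B * Q'" using A P' Q' by simp
  moreover have "invertible_mat P'" "invertible_mat Q'"
    using PQ P' Q' invertible_mat_iff by blast+
  ultimately show ?thesis
    using unimodular_equivI[OF unimodular_equiv_carrier[OF AB A] P'(1) _ Q'(1)] by simp
qed

lemma unimodular_equiv_transpose:
  assumes AB: "unimodular_equiv A B"
  shows "unimodular_equiv A\<^sup>T B\<^sup>T"
proof -
  define m n where "m = dim_row A" and "n = dim_col A"
  have A: "A \<in> carrier_mat m n" unfolding m_def n_def by auto
  obtain P Q where PQ: "P \<in> carrier_mat m m" "invertible_mat P"
    "Q \<in> carrier_mat n n" "invertible_mat Q" "B = P * A * Q"
    using AB A by (rule unimodular_equivE)
  have "B\<^sup>T = Q\<^sup>T * (A\<^sup>T * P\<^sup>T)"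
    using A PQ transpose_mult[of "P * A" m n Q n] transpose_mult[of P m m A n] by simp
  also have "\<dots> = Q\<^sup>T * A\<^sup>T * P\<^sup>T"
    using A PQ by (simp add: assoc_mult_mat[of _ n n _ m _ m])
  finally show ?thesis
    using unimodular_equivI[of "A\<^sup>T" n m "Q\<^sup>T" "P\<^sup>T"] A PQ invertible_mat_transpose by auto
qed

section \<open>Minors and divisibility\<close>

text \<open>
  A submatrix whose rows and columns are given by index functions, which may repeat indices or list
  them out of order. Expanding the determinant of a product produces such index functions, so
  divisibility of minors is proved in this generality although \<^const>\<open>minors\<close> uses increasing
  enumerations only.
\<close>

definition selection_mat :: "nat \<Rightarrow> 'a mat \<Rightarrow> (nat \<Rightarrow> nat) \<Rightarrow> (nat \<Rightarrow> nat) \<Rightarrow> 'a mat" where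
  "selection_mat k A f g = mat k k (\<lambda>(i, j). A $$ (f i, g j))"

lemma selection_mat_carrier [simp]: "selection_mat k A f g \<in> carrier_mat k k"
  unfolding selection_mat_def by simp

lemma transpose_selection_mat:
  assumes "\<And>i. i < k \<Longrightarrow> f i < dim_row A" "\<And>j. j < k \<Longrightarrow> g j < dim_col A"
  shows "(selection_mat k A f g)\<^sup>T = selection_mat k A\<^sup>T g f"
  unfolding selection_mat_def using assms by (intro eq_matI) auto

lemma det_selection_mat_transpose:
  assumes "\<And>i. i < k \<Longrightarrow> f i < dim_row A" "\<And>j. j < k \<Longrightarrow> g j < dim_col A"
  shows "det (selection_mat k A\<^sup>T g f) = det (selection_mat k A f g)"
  using transpose_selection_mat[of k f A g] assms det_transpose[of "selection_mat k A f g" k] by simp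

lemma submatrix_eq_selection_mat:
  assumes "I \<subseteq> {..<dim_row A}" "J \<subseteq> {..<dim_col A}" "card I = k" "card J = k"
  shows "submatrix A I J = selection_mat k A (pick I) (pick J)"
proof -
  have "{i. i < dim_row A \<and> i \<in> I} = I" "{j. j < dim_col A \<and> j \<in> J} = J" using assms by auto
  then show ?thesis unfolding submatrix_def selection_mat_def using assms by simp
qed

lemma minors_eq_selection:
  "minors k A = {det (selection_mat k A (pick I) (pick J)) | I J.
     I \<subseteq> {..<dim_row A} \<and> J \<subseteq> {..<dim_col A} \<and> card I = k \<and> card J = k}"
proof -
  have "x = det (submatrix A I J) \<and> I \<subseteq> {..<dim_row A} \<and> J \<subseteq> {..<dim_col A} \<and> card I = k \<and> card J = k
    \<longleftrightarrow> x = det (selection_mat k A (pick I) (pick J)) \<and>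
      I \<subseteq> {..<dim_row A} \<and> J \<subseteq> {..<dim_col A} \<and> card I = k \<and> card J = k" for x I J
    using submatrix_eq_selection_mat[of I A J k] by metis
  then show ?thesis unfolding minors_def by simp
qed

text \<open>
  A repeated row makes the determinant vanish, and rows out of order only change it by the sign of the
  sorting permutation.
\<close>

lemma selection_rows_sorted:
  fixes A :: "int mat"
  assumes "\<And>i. i < k \<Longrightarrow> f i < m"
  shows "det (selection_mat k A f g) = 0 \<or>
    (\<exists>I s. I \<subseteq> {..<m} \<and> card I = k \<and>
       det (selection_mat k A f g) = s * det (selection_mat k A (pick I) g))"
proof (cases "inj_on f {0..<k}")
  case False
  then obtain i j where ij: "i < k" "j < k" "i \<noteq> j" "f i = f j" unfolding inj_on_def by auto
  then have "row (selection_mat k A f g) i = row (selection_mat k A f g) j"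
    unfolding selection_mat_def by (intro eq_vecI) auto
  then show ?thesis using det_identical_rows[OF selection_mat_carrier ij(3,1,2)] by blast
next
  case True
  define I where "I = f ` {0..<k}"
  have fin: "finite I" and card: "card I = k" using True unfolding I_def by (auto simp: card_image)
  \<comment> \<open>the rank of \<open>f i\<close> in its range, so that \<open>f\<close> is the increasing enumeration of \<open>I\<close> after \<open>p\<close>\<close>
  define p where "p i = (if i < k then card {a \<in> I. a < f i} else i)" for i
  have pick: "pick I (p i) = f i" if "i < k" for i
    using pick_card_in_set[of "f i" I] that unfolding p_def I_def by auto
  have "p i < k" if "i < k" for i
  proof -
    have "{a \<in> I. a < f i} \<subset> I" using that unfolding I_def by auto
    then show ?thesis using psubset_card_mono[OF fin] card that unfolding p_def by auto
  qed
  moreover have "inj_on p {0..<k}"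
    using True pick unfolding inj_on_def by (metis atLeastLessThan_iff)
  ultimately have p: "p permutes {0..<k}"
    by (intro inj_on_nat_permutes) (auto simp: p_def)
  have "selection_mat k A f g = mat k k (\<lambda>(i, j). selection_mat k A (pick I) g $$ (p i, j))"
    unfolding selection_mat_def using pick \<open>\<And>i. i < k \<Longrightarrow> p i < k\<close> by (intro eq_matI) auto
  then have "det (selection_mat k A f g) = signof p * det (selection_mat k A (pick I) g)"
    using det_permute_rows[OF selection_mat_carrier[of k A "pick I" g] p] by simp
  moreover have "I \<subseteq> {..<m}" using assms unfolding I_def by auto
  ultimately show ?thesis using card by blast
qed

text \<open>
  Row indices are sorted directly and column indices in the transpose.
\<close>

lemma dvd_det_selection_mat:
  assumes A: "A \<in> carrier_mat m n" and d: "\<And>x. x \<in> minors k A \<Longrightarrow> d dvd x"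
    and f: "\<And>i. i < k \<Longrightarrow> f i < m" and g: "\<And>j. j < k \<Longrightarrow> g j < n"
  shows "d dvd det (selection_mat k A f g)"
proof -
  have pick_lt: "pick I i < N" if "I \<subseteq> {..<N}" "card I = k" "i < k" for I i N
    using pick_in_set_le[of i I] that by auto
  have step: "d dvd det (selection_mat k A (pick I) g)" if I: "I \<subseteq> {..<m}" "card I = k" for I
  proof -
    have eq: "det (selection_mat k A\<^sup>T h (pick I)) = det (selection_mat k A (pick I) h)"
      if "\<And>j. j < k \<Longrightarrow> h j < n" for h
      using A that I pick_lt by (intro det_selection_mat_transpose) auto
    have "d dvd det (selection_mat k A (pick I) (pick J))" if "J \<subseteq> {..<n}" "card J = k" for J
      using d I that A unfolding minors_eq_selection by auto
    then have "d dvd det (selection_mat k A\<^sup>T (pick J) (pick I))" if "J \<subseteq> {..<n}" "card J = k" for J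
      using eq[of "pick J"] pick_lt that by simp
    then have "d dvd det (selection_mat k A\<^sup>T g (pick I))"
      using selection_rows_sorted[of k g n "A\<^sup>T" "pick I", OF g] by auto
    then show ?thesis using eq[OF g] by simp
  qed
  then show ?thesis
    using selection_rows_sorted[of k f m A g, OF f] by auto
qed

text \<open>
  A weak form of the Cauchy--Binet formula: each row of the product is a linear combination of rows
  of \<open>A\<close>, and the determinant is multilinear in the rows. The sum runs over all index functions
  \<open>h\<close> from \<open>{0..<k}\<close> to \<open>{0..<m}\<close>, made unique by \<open>h i = i\<close> elsewhere.
\<close>

lemma det_selection_mat_mult:
  fixes P A :: "'a :: comm_ring_1 mat"
  assumes P: "P \<in> carrier_mat l m" and A: "A \<in> carrier_mat m n"
    and f: "\<And>i. i < k \<Longrightarrow> f i < l" and g: "\<And>j. j < k \<Longrightarrow> g j < n"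
  shows "det (selection_mat k (P * A) f g) =
    (\<Sum>h | (\<forall>i\<in>{0..<k}. h i \<in> {0..<m}) \<and> (\<forall>i. i \<notin> {0..<k} \<longrightarrow> h i = i).
       (\<Prod>i = 0..<k. P $$ (f i, h i)) * det (selection_mat k A h g))"
proof -
  define r where "r h = vec k (\<lambda>j. A $$ (h, g j))" for h
  have r: "r h \<in> carrier_vec k" for h unfolding r_def by simp
  have "selection_mat k (P * A) f g =
      mat\<^sub>r k k (\<lambda>i. finsum_vec TYPE('a) k (\<lambda>h. P $$ (f i, h) \<cdot>\<^sub>v r h) {0..<m})"
  proof (rule eq_matI)
    fix i j assume ij: "i < dim_row (mat\<^sub>r k k (\<lambda>i. finsum_vec TYPE('a) k (\<lambda>h. P $$ (f i, h) \<cdot>\<^sub>v r h) {0..<m}))"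
      "j < dim_col (mat\<^sub>r k k (\<lambda>i. finsum_vec TYPE('a) k (\<lambda>h. P $$ (f i, h) \<cdot>\<^sub>v r h) {0..<m}))"
    then have "finsum_vec TYPE('a) k (\<lambda>h. P $$ (f i, h) \<cdot>\<^sub>v r h) {0..<m} $ j
        = (\<Sum>h = 0..<m. (P $$ (f i, h) \<cdot>\<^sub>v r h) $ j)"
      using r by (intro index_finsum_vec) auto
    then show "selection_mat k (P * A) f g $$ (i, j) =
        mat\<^sub>r k k (\<lambda>i. finsum_vec TYPE('a) k (\<lambda>h. P $$ (f i, h) \<cdot>\<^sub>v r h) {0..<m}) $$ (i, j)"
      using ij P A f g by (simp add: selection_mat_def scalar_prod_def r_def)
  qed (auto simp: selection_mat_def)
  also have "det \<dots> = (\<Sum>h | (\<forall>i\<in>{0..<k}. h i \<in> {0..<m}) \<and> (\<forall>i. i \<notin> {0..<k} \<longrightarrow> h i = i).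
      det (mat\<^sub>r k k (\<lambda>i. P $$ (f i, h i) \<cdot>\<^sub>v r (h i))))"
    using r by (intro det_linear_rows_sum) auto
  also have "\<dots> = (\<Sum>h | (\<forall>i\<in>{0..<k}. h i \<in> {0..<m}) \<and> (\<forall>i. i \<notin> {0..<k} \<longrightarrow> h i = i).
      (\<Prod>i = 0..<k. P $$ (f i, h i)) * det (selection_mat k A h g))"
  proof (intro sum.cong refl)
    fix h :: "nat \<Rightarrow> nat"
    have "mat\<^sub>r k k (\<lambda>i. r (h i)) = selection_mat k A h g"
      by (rule eq_matI) (simp_all add: selection_mat_def r_def)
    then show "det (mat\<^sub>r k k (\<lambda>i. P $$ (f i, h i) \<cdot>\<^sub>v r (h i))) =
        (\<Prod>i = 0..<k. P $$ (f i, h i)) * det (selection_mat k A h g)"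
      using det_rows_mul[of "\<lambda>i. r (h i)" k "\<lambda>i. P $$ (f i, h i)"] r by simp
  qed
  finally show ?thesis .
qed

lemma dvd_minors_mult_left:
  assumes P: "P \<in> carrier_mat l m" and A: "A \<in> carrier_mat m n"
    and d: "\<And>x. x \<in> minors k A \<Longrightarrow> d dvd x" and x: "x \<in> minors k (P * A)"
  shows "d dvd x"
proof -
  obtain I J where IJ: "I \<subseteq> {..<l}" "J \<subseteq> {..<n}" "card I = k" "card J = k"
    and x: "x = det (selection_mat k (P * A) (pick I) (pick J))"
    using x P A unfolding minors_eq_selection by auto
  have lt: "pick I i < l" "pick J i < n" if "i < k" for i
    using pick_in_set_le[of i I] pick_in_set_le[of i J] IJ that by auto
  show ?thesis
    unfolding x
    by (subst det_selection_mat_mult[OF P A lt])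
      (auto intro!: dvd_sum dvd_mult dvd_det_selection_mat[OF A d] lt)
qed

lemma minors_transpose: "minors k A\<^sup>T = minors k A"
proof -
  have "minors k A \<subseteq> minors k A\<^sup>T" for A
  proof
    fix x assume "x \<in> minors k A"
    then obtain I J where IJ: "I \<subseteq> {..<dim_row A}" "J \<subseteq> {..<dim_col A}" "card I = k" "card J = k"
      and x: "x = det (selection_mat k A (pick I) (pick J))"
      unfolding minors_eq_selection by auto
    have "pick I i < dim_row A" "pick J i < dim_col A" if "i < k" for i
      using pick_in_set_le[of i I] pick_in_set_le[of i J] IJ that by auto
    then have "x = det (selection_mat k A\<^sup>T (pick J) (pick I))"
      unfolding x by (simp add: det_selection_mat_transpose)
    then show "x \<in> minors k A\<^sup>T" using IJ unfolding minors_eq_selection by auto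
  qed
  from this[of A] this[of "A\<^sup>T"] show ?thesis by auto
qed

text \<open>
  The right factor is treated as a left factor of the transpose.
\<close>

lemma dvd_minors_unimodular_equiv:
  assumes AB: "unimodular_equiv A B"
    and d: "\<And>x. x \<in> minors k A \<Longrightarrow> d dvd x" and x: "x \<in> minors k B"
  shows "d dvd x"
proof -
  define m n where "m = dim_row A" and "n = dim_col A"
  have A: "A \<in> carrier_mat m n" unfolding m_def n_def by auto
  obtain P Q where PQ: "P \<in> carrier_mat m m" "Q \<in> carrier_mat n n" "B = P * A * Q"
    using AB A by (rule unimodular_equivE)
  have PA: "d dvd y" if "y \<in> minors k (P * A)" for y
    using dvd_minors_mult_left[OF PQ(1) A d that] .
  have "B\<^sup>T = Q\<^sup>T * (P * A)\<^sup>T" using PQ A transpose_mult[of "P * A" m n Q n] by simp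
  then have "x \<in> minors k (Q\<^sup>T * (P * A)\<^sup>T)" using x by (metis minors_transpose)
  then show ?thesis
    using dvd_minors_mult_left[of "Q\<^sup>T" n n "(P * A)\<^sup>T" m k d x] PQ A PA
    by (simp add: minors_transpose)
qed

lemma Gcd_minors_unimodular_equiv:
  assumes "unimodular_equiv A B"
  shows "Gcd (minors k A) = Gcd (minors k B)"
proof (rule associated_eqI)
  show "Gcd (minors k A) dvd Gcd (minors k B)"
    by (rule Gcd_greatest) (rule dvd_minors_unimodular_equiv[OF assms Gcd_dvd])
  show "Gcd (minors k B) dvd Gcd (minors k A)"
    by (rule Gcd_greatest)
      (rule dvd_minors_unimodular_equiv[OF unimodular_equiv_sym[OF assms] Gcd_dvd])
qed simp_all

section \<open>Ideals of the integers\<close>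

lemma ideal_int_principal:
  assumes "ideal I \<Z>"
  obtains a where "I = range ((*) a)"
proof (cases "I \<subseteq> {0}")
  case True
  have "0 \<in> I" using additive_subgroup.zero_closed[OF ideal.axioms(1)[OF assms]] by simp
  then have "I = range ((*) 0)" using True by auto
  then show thesis by (rule that)
next
  case False
  have add: "x + y \<in> I" if "x \<in> I" "y \<in> I" for x y
    using additive_subgroup.a_closed[OF ideal.axioms(1)[OF assms]] that by simp
  have mult: "z * x \<in> I" if "x \<in> I" for x z
    using ideal.I_l_closed[OF assms that, of z] by simp
  \<comment> \<open>the generator is a nonzero element of least absolute value, by division with remainder\<close>
  define a where "a = arg_min (\<lambda>x. nat \<bar>x\<bar>) (\<lambda>x. x \<in> I \<and> x \<noteq> 0)"
  obtain b where "b \<in> I \<and> b \<noteq> 0" using False by auto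
  then have a: "a \<in> I" "a \<noteq> 0" and min: "x \<in> I \<Longrightarrow> x \<noteq> 0 \<Longrightarrow> nat \<bar>a\<bar> \<le> nat \<bar>x\<bar>" for x
    using arg_min_nat_lemma[of "\<lambda>x. x \<in> I \<and> x \<noteq> 0" b "\<lambda>x. nat \<bar>x\<bar>"] unfolding a_def by auto
  have "a dvd x" if "x \<in> I" for x
  proof -
    have "x mod a = x + (- (x div a)) * a" by (simp add: minus_div_mult_eq_mod)
    then have "x mod a \<in> I" using add[OF that mult[OF a(1)]] by metis
    moreover have "nat \<bar>x mod a\<bar> < nat \<bar>a\<bar>" using abs_mod_less[OF a(2), of x] by simp
    ultimately show ?thesis using min by (metis leD mod_0_imp_dvd)
  qed
  then have "I = range ((*) a)" using mult[OF a(1)] by (auto simp: dvd_def mult.commute)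
  then show thesis by (rule that)
qed

text \<open>
  A generator of the ideal divides all elements of \<open>S\<close>, hence the gcd, so the gcd itself lies in
  the ideal (Bezout).
\<close>

lemma Idl_int_eq_multiples_Gcd:
  fixes S :: "int set"
  shows "Idl\<^bsub>\<Z>\<^esub> S = {x. Gcd S dvd x}"
proof
  have "ideal (range ((*) (Gcd S))) \<Z>"
    using int.genideal_ideal[of "{Gcd S}"] by (simp add: int_Idl full_SetCompr_eq mult.commute)
  moreover have "S \<subseteq> range ((*) (Gcd S))"
    using Gcd_dvd[of _ S] by (auto simp: dvd_def)
  ultimately have "Idl\<^bsub>\<Z>\<^esub> S \<subseteq> range ((*) (Gcd S))" by (rule int.genideal_minimal)
  then show "Idl\<^bsub>\<Z>\<^esub> S \<subseteq> {x. Gcd S dvd x}" by auto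
  have "ideal (Idl\<^bsub>\<Z>\<^esub> S) \<Z>" by (rule int.genideal_ideal) simp
  then obtain a where a: "Idl\<^bsub>\<Z>\<^esub> S = range ((*) a)" by (rule ideal_int_principal)
  then have "a dvd Gcd S"
    using int.genideal_self[of S] by (intro Gcd_greatest) auto
  then show "{x. Gcd S dvd x} \<subseteq> Idl\<^bsub>\<Z>\<^esub> S" unfolding a by (auto simp: dvd_def)
qed

lemma Idl_int_eq_iff_Gcd_eq:
  fixes S T :: "int set"
  shows "Idl\<^bsub>\<Z>\<^esub> S = Idl\<^bsub>\<Z>\<^esub> T \<longleftrightarrow> Gcd S = Gcd T"
  unfolding Idl_int_eq_multiples_Gcd
  by (metis (mono_tags, lifting) associated_eqI dvd_refl mem_Collect_eq normalize_Gcd)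

section \<open>Existence of the Smith normal form\<close>

text \<open>
  Adding multiples of a pivot row \<open>p\<close> to all other rows at once. This is the only operation
  needed to reach a diagonal matrix: column operations are obtained by transposition, and row swaps
  are avoided because a multiple of one row can be added to create a wanted entry in another.
\<close>

definition add_rows :: "(nat \<Rightarrow> 'a) \<Rightarrow> nat \<Rightarrow> 'a :: comm_ring_1 mat \<Rightarrow> 'a mat" where
  "add_rows q p A = mat (dim_row A) (dim_col A)
     (\<lambda>(i, j). A $$ (i, j) + (if i = p then 0 else q i) * A $$ (p, j))"

definition add_cols :: "(nat \<Rightarrow> 'a) \<Rightarrow> nat \<Rightarrow> 'a :: comm_ring_1 mat \<Rightarrow> 'a mat" where
  "add_cols q p A = (add_rows q p A\<^sup>T)\<^sup>T"

lemma add_rows_dim [simp]: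
  "dim_row (add_rows q p A) = dim_row A" "dim_col (add_rows q p A) = dim_col A"
  by (simp_all add: add_rows_def)

lemma add_rows_index:
  assumes "A \<in> carrier_mat m n" "i < m" "j < n"
  shows "add_rows q p A $$ (i, j) = A $$ (i, j) + (if i = p then 0 else q i) * A $$ (p, j)"
  using assms unfolding add_rows_def by auto

lemma add_cols_index:
  assumes "A \<in> carrier_mat m n" "i < m" "j < n" "p < n"
  shows "add_cols q p A $$ (i, j) = A $$ (i, j) + (if j = p then 0 else q j) * A $$ (i, p)"
  using assms unfolding add_cols_def add_rows_def by auto

lemma unimodular_equiv_add_rows:
  assumes A: "A \<in> carrier_mat m n" and p: "p < m"
  shows "unimodular_equiv A (add_rows q p A)"
proof -
  \<comment> \<open>elementary matrices: \<open>E r * X\<close> adds \<open>r i\<close> times row \<open>p\<close> to every other row \<open>i\<close>, and \<open>E (- r)\<close> undoes it\<close>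
  define E :: "(nat \<Rightarrow> int) \<Rightarrow> int mat" where
    "E r = mat m m (\<lambda>(i, j). (if i = j then 1 else 0) + (if j = p then if i = p then 0 else r i else 0))"
    for r
  have E: "E r \<in> carrier_mat m m" for r unfolding E_def by simp
  have mult: "E r * X = add_rows r p X" if X: "X \<in> carrier_mat m l" for r X l
  proof (rule eq_matI)
    fix i j assume "i < dim_row (add_rows r p X)" "j < dim_col (add_rows r p X)"
    then have ij: "i < m" "j < l" using X by auto
    have "(E r * X) $$ (i, j) = (\<Sum>h = 0..<m. E r $$ (i, h) * X $$ (h, j))"
      using ij X E[of r] by (simp add: scalar_prod_def)
    also have "\<dots> = (\<Sum>h = 0..<m. (if i = h then X $$ (h, j) else 0) +
        (if h = p then (if i = p then 0 else r i) * X $$ (h, j) else 0))"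
      using ij by (intro sum.cong refl) (simp add: E_def)
    also have "\<dots> = add_rows r p X $$ (i, j)"
      using ij p X by (simp add: sum.distrib add_rows_index)
    finally show "(E r * X) $$ (i, j) = add_rows r p X $$ (i, j)" .
  qed (use X E[of r] in auto)
  have inv: "E r * E (\<lambda>i. - r i) = 1\<^sub>m m" for r
  proof -
    have "add_rows r p (E (\<lambda>i. - r i)) = 1\<^sub>m m"
      by (rule eq_matI) (use p in \<open>auto simp: add_rows_def E_def\<close>)
    then show ?thesis using mult[OF E] by simp
  qed
  have "invertible_mat (E q)"
    using inv[of q] inv[of "\<lambda>i. - q i"] E invertible_mat_iff[OF E, of q] by auto
  then show ?thesis
    using unimodular_equiv_left[OF A E, of q] mult[OF A] by simp
qed

text \<open>
  The invariant of the reduction after \<open>k\<close> pivots: outside the diagonal the first \<open>k\<close> rows and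
  columns vanish, and each of the first \<open>k\<close> diagonal entries divides all entries weakly below and
  to the right of it. The latter is stronger than divisibility along the diagonal so that it survives
  operations on the remaining rows and columns. Signs are left for the end.
\<close>

definition snf_upto :: "nat \<Rightarrow> int mat \<Rightarrow> bool" where
  "snf_upto k A \<longleftrightarrow>
     (\<forall>i < dim_row A. \<forall>j < dim_col A. i \<noteq> j \<and> (i < k \<or> j < k) \<longrightarrow> A $$ (i, j) = 0) \<and>
     (\<forall>h < k. \<forall>i < dim_row A. \<forall>j < dim_col A. h \<le> i \<and> h \<le> j \<longrightarrow> A $$ (h, h) dvd A $$ (i, j))"

lemma snf_upto_transpose:
  assumes "snf_upto k A" "k \<le> dim_row A" "k \<le> dim_col A"
  shows "snf_upto k A\<^sup>T"
  using assms unfolding snf_upto_def by auto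

text \<open>
  Row \<open>p \<ge> k\<close> vanishes in the first \<open>k\<close> columns, and new entries are integer combinations of
  entries that the earlier pivots divide.
\<close>

lemma snf_upto_add_rows:
  assumes A: "A \<in> carrier_mat m n" and k: "k \<le> m" "k \<le> n" and snf: "snf_upto k A"
    and p: "k \<le> p" "p < m" and q: "\<And>i. i < k \<Longrightarrow> q i = 0"
  shows "snf_upto k (add_rows q p A)"
proof -
  have zero: "A $$ (i, j) = 0" if "i < m" "j < n" "i \<noteq> j" "i < k \<or> j < k" for i j
    using snf that A unfolding snf_upto_def by auto
  have dvd: "A $$ (h, h) dvd A $$ (i, j)" if "h < k" "i < m" "j < n" "h \<le> i" "h \<le> j" for h i j
    using snf that A unfolding snf_upto_def by auto
  have "add_rows q p A $$ (i, j) = 0" if "i < m" "j < n" "i \<noteq> j" "i < k \<or> j < k" for i j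
    using that zero[of i j] zero[of p j] q[of i] p by (auto simp: add_rows_index[OF A])
  moreover have "add_rows q p A $$ (h, h) dvd add_rows q p A $$ (i, j)"
    if "h < k" "i < m" "j < n" "h \<le> i" "h \<le> j" for h i j
  proof -
    have "add_rows q p A $$ (h, h) = A $$ (h, h)"
      using that k q[of h] by (simp add: add_rows_index[OF A])
    moreover have "A $$ (h, h) dvd add_rows q p A $$ (i, j)"
      using that p dvd[of h i j] dvd[of h p j] by (simp add: add_rows_index[OF A])
    ultimately show ?thesis by simp
  qed
  ultimately show ?thesis unfolding snf_upto_def using A by auto
qed

lemma unimodular_equiv_add_cols:
  assumes A: "A \<in> carrier_mat m n" and p: "p < n"
  shows "unimodular_equiv A (add_cols q p A)"
  using unimodular_equiv_transpose[OF unimodular_equiv_add_rows[of "A\<^sup>T" n m p q]] A p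
  unfolding add_cols_def by simp

lemma snf_upto_add_cols:
  assumes A: "A \<in> carrier_mat m n" and k: "k \<le> m" "k \<le> n" and snf: "snf_upto k A"
    and p: "k \<le> p" "p < n" and q: "\<And>i. i < k \<Longrightarrow> q i = 0"
  shows "snf_upto k (add_cols q p A)"
  unfolding add_cols_def using assms
  by (intro snf_upto_transpose snf_upto_add_rows[of _ n m]) auto

lemma snf_upto_SucI:
  assumes A: "A \<in> carrier_mat m n" and snf: "snf_upto k A"
    and col: "\<And>i. k < i \<Longrightarrow> i < m \<Longrightarrow> A $$ (i, k) = 0"
    and row: "\<And>j. k < j \<Longrightarrow> j < n \<Longrightarrow> A $$ (k, j) = 0"
    and dvd: "\<And>i j. k \<le> i \<Longrightarrow> i < m \<Longrightarrow> k \<le> j \<Longrightarrow> j < n \<Longrightarrow> A $$ (k, k) dvd A $$ (i, j)"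
  shows "snf_upto (Suc k) A"
proof -
  have "A $$ (i, j) = 0" if "i < m" "j < n" "i \<noteq> j" "i < Suc k \<or> j < Suc k" for i j
  proof (cases "i < k \<or> j < k")
    case True
    then show ?thesis using snf that A unfolding snf_upto_def by auto
  next
    case False
    then have "i = k \<and> k < j \<or> j = k \<and> k < i" using that by auto
    then show ?thesis using row col that by auto
  qed
  moreover have "A $$ (h, h) dvd A $$ (i, j)" if "h < Suc k" "i < m" "j < n" "h \<le> i" "h \<le> j" for h i j
    using snf dvd[of i j] A that unfolding snf_upto_def by (cases "h = k") auto
  ultimately show ?thesis
    using A unfolding snf_upto_def by blast
qed

text \<open>
  Among all entries in the unreduced block of all matrices reachable from \<open>A\<close> by unimodular
  equivalence, take a nonzero one of least absolute value \<open>g\<close>. A remainder modulo such an entry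
  is again an entry of a reachable matrix, so by minimality the entry divides its whole row and
  column. Hence it can be moved to position \<open>(k, k)\<close>, used to clear its row and column, and then
  divides every entry of the block, since adding another row to row \<open>k\<close> leaves the pivot unchanged.
\<close>

lemma snf_upto_Suc_step:
  assumes A: "A \<in> carrier_mat m n" and snf: "snf_upto k A" and k: "k < m" "k < n"
  shows "\<exists>B. unimodular_equiv A B \<and> snf_upto (Suc k) B"
proof (cases "\<forall>i j. k \<le> i \<and> i < m \<and> k \<le> j \<and> j < n \<longrightarrow> A $$ (i, j) = 0")
  case True
  have "snf_upto (Suc k) A"
    using True k by (intro snf_upto_SucI[OF A snf]) auto
  then show ?thesis using unimodular_equiv_refl by blast
next
  case False
  define reach where "reach C \<longleftrightarrow> unimodular_equiv A C \<and> snf_upto k C" for C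
  have carrier: "C \<in> carrier_mat m n" if "reach C" for C
    using that A unimodular_equiv_carrier unfolding reach_def by blast
  have reach_rows: "reach (add_rows q p C)"
    if "reach C" "k \<le> p" "p < m" "\<And>i. i < k \<Longrightarrow> q i = 0" for C p q
    using that carrier[OF that(1)] k unimodular_equiv_trans unimodular_equiv_add_rows
      snf_upto_add_rows[of C m n k p q] unfolding reach_def by (metis less_imp_le)
  have reach_cols: "reach (add_cols q p C)"
    if "reach C" "k \<le> p" "p < n" "\<And>i. i < k \<Longrightarrow> q i = 0" for C p q
    using that carrier[OF that(1)] k unimodular_equiv_trans unimodular_equiv_add_cols
      snf_upto_add_cols[of C m n k p q] unfolding reach_def by (metis less_imp_le)
  define attained where "attained g \<longleftrightarrow> (\<exists>C i j. reach C \<and> k \<le> i \<and> i < m \<and> k \<le> j \<and> j < n \<and>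
      C $$ (i, j) \<noteq> 0 \<and> nat \<bar>C $$ (i, j)\<bar> = g)" for g
  define g where "g = (LEAST g. attained g)"
  have "\<exists>g. attained g"
    using False snf unimodular_equiv_refl[of A] unfolding attained_def reach_def by blast
  then have attained: "attained g" unfolding g_def by (rule LeastI_ex)
  have least: "g \<le> nat \<bar>C $$ (i, j)\<bar>"
    if "reach C" "k \<le> i" "i < m" "k \<le> j" "j < n" "C $$ (i, j) \<noteq> 0" for C i j
    unfolding g_def by (rule Least_le) (use that attained_def in blast)
  have g: "g > 0" using attained unfolding attained_def by auto
  have col_dvd: "C $$ (i, j) dvd C $$ (i', j)"
    if C: "reach C" and ij: "k \<le> i" "i < m" "k \<le> j" "j < n" "k \<le> i'" "i' < m"
      and min: "nat \<bar>C $$ (i, j)\<bar> = g" for C i j i'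
  proof (cases "i' = i")
    case False
    define D where "D = add_rows (\<lambda>r. if r = i' then - (C $$ (i', j) div C $$ (i, j)) else 0) i C"
    have "reach D" unfolding D_def using ij by (intro reach_rows[OF C]) auto
    moreover have "D $$ (i', j) = C $$ (i', j) mod C $$ (i, j)"
      using ij False unfolding D_def
      by (simp add: add_rows_index[OF carrier[OF C]] minus_div_mult_eq_mod)
    moreover have "\<bar>C $$ (i', j) mod C $$ (i, j)\<bar> < \<bar>C $$ (i, j)\<bar>"
      using min g by (intro abs_mod_less) auto
    ultimately have "C $$ (i', j) mod C $$ (i, j) = 0"
      using least[of D i' j] ij min by fastforce
    then show ?thesis by auto
  qed simp
  have row_dvd: "C $$ (i, j) dvd C $$ (i, j')"
    if C: "reach C" and ij: "k \<le> i" "i < m" "k \<le> j" "j < n" "k \<le> j'" "j' < n"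
      and min: "nat \<bar>C $$ (i, j)\<bar> = g" for C i j j'
  proof (cases "j' = j")
    case False
    define D where "D = add_cols (\<lambda>r. if r = j' then - (C $$ (i, j') div C $$ (i, j)) else 0) j C"
    have "reach D" unfolding D_def using ij by (intro reach_cols[OF C]) auto
    moreover have "D $$ (i, j') = C $$ (i, j') mod C $$ (i, j)"
      using ij False unfolding D_def
      by (simp add: add_cols_index[OF carrier[OF C]] minus_div_mult_eq_mod)
    moreover have "\<bar>C $$ (i, j') mod C $$ (i, j)\<bar> < \<bar>C $$ (i, j)\<bar>"
      using min g by (intro abs_mod_less) auto
    ultimately have "C $$ (i, j') mod C $$ (i, j) = 0"
      using least[of D i j'] ij min by fastforce
    then show ?thesis by auto
  qed simp
  obtain C i j where C: "reach C" and ij: "k \<le> i" "i < m" "k \<le> j" "j < n"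
    and min_C: "nat \<bar>C $$ (i, j)\<bar> = g" using attained unfolding attained_def by auto
  obtain D where D: "reach D" and min_D: "nat \<bar>D $$ (k, j)\<bar> = g"
  proof (cases "i = k")
    case False
    \<comment> \<open>since \<open>C $$ (i, j)\<close> divides its column, a multiple of row \<open>i\<close> turns \<open>C $$ (k, j)\<close> into a copy of it\<close>
    define D where "D = add_rows (\<lambda>r. if r = k then 1 - C $$ (k, j) div C $$ (i, j) else 0) i C"
    have "reach D" unfolding D_def using ij by (intro reach_rows[OF C]) auto
    moreover have "D $$ (k, j) = C $$ (i, j)"
      using ij k False col_dvd[OF C ij _ _ min_C, of k] unfolding D_def
      by (simp add: add_rows_index[OF carrier[OF C]] left_diff_distrib)
    ultimately show ?thesis using that min_C by simp
  qed (use C min_C that in auto)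
  obtain E where E: "reach E" and min_E: "nat \<bar>E $$ (k, k)\<bar> = g"
  proof (cases "j = k")
    case False
    \<comment> \<open>the same with columns, giving the pivot \<open>(k, k)\<close>\<close>
    define E where "E = add_cols (\<lambda>r. if r = k then 1 - D $$ (k, k) div D $$ (k, j) else 0) j D"
    have "reach E" unfolding E_def using ij by (intro reach_cols[OF D]) auto
    moreover have "E $$ (k, k) = D $$ (k, j)"
      using ij k False row_dvd[OF D _ k(1) ij(3,4) _ k(2) min_D] unfolding E_def
      by (simp add: add_cols_index[OF carrier[OF D]] left_diff_distrib)
    ultimately show ?thesis using that min_D by simp
  qed (use D min_D that in auto)
  define F where "F = add_rows (\<lambda>r. if k < r then - (E $$ (r, k) div E $$ (k, k)) else 0) k E"
  have F: "reach F" unfolding F_def using k by (intro reach_rows[OF E]) auto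
  have F_kk: "F $$ (k, k) = E $$ (k, k)"
    unfolding F_def using k by (simp add: add_rows_index[OF carrier[OF E]])
  have F_col: "F $$ (r, k) = 0" if "k < r" "r < m" for r
    using that k col_dvd[OF E _ k(1) _ k(2) _ _ min_E, of r] unfolding F_def
    by (simp add: add_rows_index[OF carrier[OF E]])
  define G where "G = add_cols (\<lambda>c. if k < c then - (F $$ (k, c) div F $$ (k, k)) else 0) k F"
  have G: "reach G" unfolding G_def using k by (intro reach_cols[OF F]) auto
  have G_kk: "nat \<bar>G $$ (k, k)\<bar> = g"
    unfolding G_def using k F_kk min_E by (simp add: add_cols_index[OF carrier[OF F]])
  have G_col: "G $$ (r, k) = 0" if "k < r" "r < m" for r
    using that k F_col unfolding G_def by (simp add: add_cols_index[OF carrier[OF F]])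
  have G_row: "G $$ (k, c) = 0" if "k < c" "c < n" for c
    using that k row_dvd[OF F _ k(1) _ k(2), of c] F_kk min_E unfolding G_def
    by (simp add: add_cols_index[OF carrier[OF F]])
  have G_dvd: "G $$ (k, k) dvd G $$ (r, c)" if rc: "k \<le> r" "r < m" "k \<le> c" "c < n" for r c
  proof (cases "r = k")
    case True
    then show ?thesis using row_dvd[OF G _ k(1) _ k(2) _ _ G_kk] rc by simp
  next
    case False
    \<comment> \<open>row \<open>k\<close> of \<open>G\<close> is zero apart from its pivot, so row \<open>k\<close> of \<open>H\<close> shows the entries of row \<open>r\<close>\<close>
    define H where "H = add_rows (\<lambda>i. if i = k then 1 else 0) r G"
    have H: "reach H" unfolding H_def using rc False by (intro reach_rows[OF G]) auto
    have "H $$ (k, k) = G $$ (k, k)" "H $$ (k, c) = G $$ (k, c) + G $$ (r, c)"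
      using False rc k G_col[of r] unfolding H_def by (simp_all add: add_rows_index[OF carrier[OF G]])
    then have "G $$ (k, k) dvd G $$ (k, c) + G $$ (r, c)"
      using row_dvd[OF H _ k(1) _ k(2) _ rc(4)] rc G_kk by simp
    moreover have "G $$ (k, k) dvd G $$ (k, c)"
      using row_dvd[OF G _ k(1) _ k(2) _ rc(4) G_kk] rc by simp
    ultimately show ?thesis by (simp add: dvd_add_right_iff)
  qed
  have "snf_upto k G" using G unfolding reach_def by simp
  then have "snf_upto (Suc k) G"
    using G_col G_row G_dvd by (rule snf_upto_SucI[OF carrier[OF G]])
  then show ?thesis using G unfolding reach_def by blast
qed

lemma unimodular_equiv_snf_upto:
  assumes A: "A \<in> carrier_mat m n" and k: "k \<le> min m n"
  shows "\<exists>B. unimodular_equiv A B \<and> snf_upto k B"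
  using k
proof (induction k)
  case 0
  show ?case using unimodular_equiv_refl[of A] by (auto simp: snf_upto_def)
next
  case (Suc k)
  then obtain B where B: "unimodular_equiv A B" "snf_upto k B" by auto
  then obtain C where "unimodular_equiv B C" "snf_upto (Suc k) C"
    using snf_upto_Suc_step[OF unimodular_equiv_carrier[OF B(1) A] B(2)] Suc.prems by auto
  then show ?case using unimodular_equiv_trans[OF B(1)] by blast
qed

text \<open>
  Both dimensions of a normal form are those of \<open>A\<close>, so the conditions can be stated without the
  dimensions of \<open>S\<close>.
\<close>

lemma is_smith_normal_form_iff:
  assumes "A \<in> carrier_mat m n"
  shows "is_smith_normal_form A S \<longleftrightarrow> unimodular_equiv A S \<and> diagonal_mat S \<and>
    (\<forall>i < min m n. 0 \<le> S $$ (i, i)) \<and>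
    (\<forall>i. Suc i < min m n \<longrightarrow> S $$ (i, i) dvd S $$ (Suc i, Suc i))"
proof (cases "unimodular_equiv A S")
  case True
  then show ?thesis
    using unimodular_equiv_carrier[OF True assms] True assms
    unfolding is_smith_normal_form_def unimodular_equiv_def by auto
next
  case False
  then show ?thesis unfolding is_smith_normal_form_def unimodular_equiv_def by blast
qed

lemma smith_normal_form_exists: "\<exists>S. is_smith_normal_form A S"
proof -
  define m n where "m = dim_row A" and "n = dim_col A"
  have A: "A \<in> carrier_mat m n" unfolding m_def n_def by auto
  obtain B where AB: "unimodular_equiv A B" and snf: "snf_upto (min m n) B"
    using unimodular_equiv_snf_upto[OF A] by blast
  have B: "B \<in> carrier_mat m n" using unimodular_equiv_carrier[OF AB A] .
  \<comment> \<open>the reduction leaves the signs of the diagonal open; scaling rows by \<open>s\<close> makes it nonnegative\<close>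
  define s :: "nat \<Rightarrow> int" where "s i = (if i < n \<and> B $$ (i, i) < 0 then - 1 else 1)" for i
  define P where "P = mat m m (\<lambda>(i, j). if i = j then s i else 0)"
  have P: "P \<in> carrier_mat m m" unfolding P_def by simp
  have PX: "(P * X) $$ (i, j) = s i * X $$ (i, j)" if "X \<in> carrier_mat m l" "i < m" "j < l" for X i j l
  proof -
    have "(P * X) $$ (i, j) = (\<Sum>h = 0..<m. (if i = h then s i * X $$ (h, j) else 0))"
      using that P by (simp add: scalar_prod_def P_def if_distrib[of "\<lambda>x. x * _"] cong: if_cong)
    then show ?thesis using that by simp
  qed
  have "P * P = 1\<^sub>m m"
    by (rule eq_matI) (auto simp: PX[OF P] P carrier_matD[OF P] simp del: index_mult_mat(1), auto simp: P_def s_def)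
  then have "invertible_mat P" using invertible_mat_iff[OF P] P by auto
  then have "unimodular_equiv A (P * B)"
    using unimodular_equiv_trans[OF AB unimodular_equiv_left[OF B P]] by simp
  moreover have "diagonal_mat (P * B)"
  proof -
    have "B $$ (i, j) = 0" if "i < m" "j < n" "i \<noteq> j" for i j
    proof -
      have "i < min m n \<or> j < min m n" using that by linarith
      then show ?thesis using snf B that unfolding snf_upto_def by auto
    qed
    then show ?thesis
      using B P unfolding diagonal_mat_def by (auto simp: PX[OF B] simp del: index_mult_mat(1))
  qed
  moreover have "0 \<le> (P * B) $$ (i, i)" if "i < min m n" for i
    using that by (auto simp: PX[OF B] s_def simp del: index_mult_mat(1))
  moreover have "(P * B) $$ (i, i) dvd (P * B) $$ (Suc i, Suc i)" if "Suc i < min m n" for i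
    using that snf B unfolding snf_upto_def
    by (auto simp: PX[OF B] s_def simp del: index_mult_mat(1))
  ultimately show ?thesis using is_smith_normal_form_iff[OF A] by blast
qed

section \<open>Determinantal divisors and uniqueness\<close>

lemma le_pick:
  assumes "i < card I"
  shows "i \<le> pick I i"
proof -
  have "card {a \<in> I. a < pick I i} \<le> card {..<pick I i}" by (rule card_mono) auto
  then show ?thesis using card_pick_le[OF assms] by simp
qed

lemma pick_lessThan: "i < k \<Longrightarrow> pick {..<k} i = i"
proof -
  assume "i < k"
  then have "{a \<in> {..<k}. a < i} = {..<i}" by auto
  then show ?thesis using pick_card_in_set[of i "{..<k}"] \<open>i < k\<close> by simp
qed

text \<open>
  The leading minor of order \<open>k\<close> is the product itself. In any other minor each nonzero entry in
  row \<open>i\<close> is a diagonal entry of \<open>S\<close> with index at least \<open>i\<close>, because the chosen rows are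
  enumerated increasingly, so the product divides every term of the Leibniz expansion.
\<close>

lemma Gcd_minors_smith_normal_form:
  assumes S: "S \<in> carrier_mat m n" and diag: "diagonal_mat S"
    and nonneg: "\<And>i. i < min m n \<Longrightarrow> 0 \<le> S $$ (i, i)"
    and dvd: "\<And>i. Suc i < min m n \<Longrightarrow> S $$ (i, i) dvd S $$ (Suc i, Suc i)"
    and k: "k \<le> min m n"
  shows "Gcd (minors k S) = (\<Prod>i<k. S $$ (i, i))"
proof (rule associated_eqI)
  have chain: "S $$ (i, i) dvd S $$ (j, j)" if "i \<le> j" "j < min m n" for i j
    using that
  proof (induction j rule: dec_induct)
    case (step j)
    have "S $$ (i, i) dvd S $$ (j, j)" using step by simp
    also have "S $$ (j, j) dvd S $$ (Suc j, Suc j)" using dvd step by simp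
    finally show ?case .
  qed simp
  have off: "S $$ (i, j) = 0" if "i < m" "j < n" "i \<noteq> j" for i j
    using that diag S unfolding diagonal_mat_def by auto
  define M where "M = selection_mat k S (pick {..<k}) (pick {..<k})"
  have M: "M \<in> carrier_mat k k" unfolding M_def by simp
  have M_index: "M $$ (i, j) = S $$ (i, j)" if "i < k" "j < k" for i j
    using that unfolding M_def selection_mat_def by (simp add: pick_lessThan)
  have "upper_triangular M" using off M M_index k by auto
  then have "det M = (\<Prod>i = 0..<k. M $$ (i, i))"
    using det_upper_triangular[OF _ M] prod_list_diag_prod[of M] M by simp
  also have "\<dots> = (\<Prod>i<k. S $$ (i, i))"
    using M_index by (simp add: atLeast0LessThan)
  finally have "(\<Prod>i<k. S $$ (i, i)) = det M" by simp
  moreover have "det M \<in> minors k S"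
    unfolding minors_eq_selection M_def using k S by (auto intro!: exI[of _ "{..<k}"])
  ultimately show "Gcd (minors k S) dvd (\<Prod>i<k. S $$ (i, i))" by simp
  show "(\<Prod>i<k. S $$ (i, i)) dvd Gcd (minors k S)"
  proof (rule Gcd_greatest)
    fix x assume "x \<in> minors k S"
    then obtain I J where IJ: "I \<subseteq> {..<m}" "J \<subseteq> {..<n}" "card I = k" "card J = k"
      and x: "x = det (selection_mat k S (pick I) (pick J))"
      using S unfolding minors_eq_selection by auto
    have lt: "pick I i < m" "pick J i < n" if "i < k" for i
      using pick_in_set_le[of i I] pick_in_set_le[of i J] IJ that by auto
    have entry: "S $$ (i, i) dvd selection_mat k S (pick I) (pick J) $$ (i, j)"
      if "i < k" "j < k" for i j
    proof (cases "pick I i = pick J j")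
      case True
      then show ?thesis
        using chain[of i "pick I i"] le_pick[of i I] lt[of i] lt[of j] IJ that
        by (simp add: selection_mat_def)
    next
      case False
      then show ?thesis using off lt that by (simp add: selection_mat_def)
    qed
    show "(\<Prod>i<k. S $$ (i, i)) dvd x"
      unfolding x det_def'[OF selection_mat_carrier]
    proof (rule dvd_sum, rule dvd_mult)
      fix p assume "p \<in> {p. p permutes {0..<k}}"
      then have "p i < k" if "i < k" for i using permutes_in_image[of p "{0..<k}" i] that by auto
      then show "(\<Prod>i<k. S $$ (i, i)) dvd
          (\<Prod>i = 0..<k. selection_mat k S (pick I) (pick J) $$ (i, p i))"
        unfolding atLeast0LessThan by (intro prod_dvd_prod) (auto intro: entry)
    qed
  qed
  show "normalize (\<Prod>i<k. S $$ (i, i)) = (\<Prod>i<k. S $$ (i, i))"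
    using prod_nonneg[of "{..<k}" "\<lambda>i. S $$ (i, i)"] nonneg k by simp
qed simp

text \<open>
  Successive quotients recover the chains while the products are nonzero. Once a product vanishes, some
  earlier term is zero in both chains, and zero divides only zero.
\<close>

lemma divisor_chain_eq_if_prods_eq:
  fixes d e :: "nat \<Rightarrow> 'a :: idom"
  assumes d: "\<And>i. Suc i < r \<Longrightarrow> d i dvd d (Suc i)" and e: "\<And>i. Suc i < r \<Longrightarrow> e i dvd e (Suc i)"
    and eq: "\<And>k. k \<le> r \<Longrightarrow> (\<Prod>i<k. d i) = (\<Prod>i<k. e i)"
    and i: "i < r"
  shows "d i = e i"
  using i
proof (induction i)
  case 0
  then show ?case using eq[of "Suc 0"] by simp
next
  case (Suc i)
  show ?case
  proof (cases "(\<Prod>j<Suc i. d j) = 0")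
    case True
    have zero: "f (Suc i) = 0"
      if chain: "\<And>i. Suc i < r \<Longrightarrow> f i dvd f (Suc i)" and prod: "(\<Prod>j<Suc i. f j) = 0" for f :: "nat \<Rightarrow> 'a"
    proof -
      obtain j where j: "j < Suc i" "f j = 0" using prod by (auto simp del: prod.lessThan_Suc)
      have "f (j + l) = 0" if "j + l \<le> Suc i" for l
        using that
      proof (induction l)
        case (Suc l)
        then show ?case using chain[of "j + l"] Suc.prems \<open>Suc i < r\<close> by simp
      qed (use j in simp)
      from this[of "Suc i - j"] show ?thesis using j by simp
    qed
    have "d (Suc i) = 0" using d True by (rule zero)
    moreover have "(\<Prod>j<Suc i. e j) = 0" using True eq[of "Suc i"] Suc.prems by (metis less_imp_le)
    with e have "e (Suc i) = 0" by (rule zero)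
    ultimately show ?thesis by simp
  next
    case False
    have "(\<Prod>j<Suc i. d j) * d (Suc i) = (\<Prod>j<Suc i. e j) * e (Suc i)"
      using eq[of "Suc (Suc i)"] Suc.prems by (metis Suc_leI prod.lessThan_Suc)
    also have "(\<Prod>j<Suc i. e j) = (\<Prod>j<Suc i. d j)"
      using eq[of "Suc i"] Suc.prems by (metis less_imp_le)
    finally show ?thesis using False mult_left_cancel by blast
  qed
qed

lemma smith_normal_forms_eq_iff:
  assumes A: "A \<in> carrier_mat m n" and B: "B \<in> carrier_mat m n"
    and S: "is_smith_normal_form A S" and T: "is_smith_normal_form B T"
  shows "S = T \<longleftrightarrow> (\<forall>k\<in>{1..min m n}. Gcd (minors k A) = Gcd (minors k B))"
proof -
  note S' = S[unfolded is_smith_normal_form_iff[OF A]] and T' = T[unfolded is_smith_normal_form_iff[OF B]]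
  have Sc: "S \<in> carrier_mat m n" and Tc: "T \<in> carrier_mat m n"
    using S' T' unimodular_equiv_carrier A B by blast+
  have GS: "Gcd (minors k A) = (\<Prod>i<k. S $$ (i, i))" if "k \<le> min m n" for k
    using Gcd_minors_unimodular_equiv[of A S k] Gcd_minors_smith_normal_form[OF Sc _ _ _ that] S' by simp
  have GT: "Gcd (minors k B) = (\<Prod>i<k. T $$ (i, i))" if "k \<le> min m n" for k
    using Gcd_minors_unimodular_equiv[of B T k] Gcd_minors_smith_normal_form[OF Tc _ _ _ that] T' by simp
  show ?thesis
  proof
    assume "S = T"
    then show "\<forall>k\<in>{1..min m n}. Gcd (minors k A) = Gcd (minors k B)" using GS GT by simp
  next
    assume eq: "\<forall>k\<in>{1..min m n}. Gcd (minors k A) = Gcd (minors k B)"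
    have prods: "(\<Prod>i<k. S $$ (i, i)) = (\<Prod>i<k. T $$ (i, i))" if "k \<le> min m n" for k
    proof (cases "k = 0")
      case False
      then show ?thesis using GS GT eq that by (metis One_nat_def Suc_leI atLeastAtMost_iff gr0I)
    qed simp
    have diag: "S $$ (i, i) = T $$ (i, i)" if "i < min m n" for i
      by (rule divisor_chain_eq_if_prods_eq[of "min m n" "\<lambda>i. S $$ (i, i)" "\<lambda>i. T $$ (i, i)"])
        (use S' T' prods that in auto)
    show "S = T"
    proof (rule eq_matI)
      fix i j assume "i < dim_row T" "j < dim_col T"
      then show "S $$ (i, j) = T $$ (i, j)"
        using diag[of i] S' T' Sc Tc unfolding diagonal_mat_def by (cases "i = j") auto
    qed (use Sc Tc in auto)
  qed
qed

lemma smith_normal_form_correct: "is_smith_normal_form A (smith_normal_form A)"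
  unfolding smith_normal_form_def
proof (rule theI')
  obtain S where S: "is_smith_normal_form A S" using smith_normal_form_exists by blast
  have A: "A \<in> carrier_mat (dim_row A) (dim_col A)" by simp
  have "T = S" if "is_smith_normal_form A T" for T
    using smith_normal_forms_eq_iff[OF A A that S] by simp
  then show "\<exists>!S. is_smith_normal_form A S" using S by blast
qed

theorem smith_normal_form_eq_iff_determinantal_ideal_eq:
  assumes A: "A \<in> carrier_mat m n" and B: "B \<in> carrier_mat m n"
  shows "smith_normal_form A = smith_normal_form B \<longleftrightarrow>
    (\<forall>k\<in>{1..min m n}. determinantal_ideal k A = determinantal_ideal k B)"
  unfolding determinantal_ideal_def Idl_int_eq_iff_Gcd_eq
  by (rule smith_normal_forms_eq_iff[OF A B smith_normal_form_correct smith_normal_form_correct])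

section \<open>Matrices of graphs\<close>

lemma graph_mat_carrier: "graph_mat M G vs \<in> carrier_mat (length vs) (length vs)"
proof (rule carrier_matI)
  show "dim_row (graph_mat M G vs) = length vs" "dim_col (graph_mat M G vs) = length vs"
    by (cases M; simp add: adjacency_mat_def laplacian_mat_def distance_mat_def
        distance_laplacian_mat_def)+
qed

theorem theorem35:
  fixes G :: "('a, 'b) pre_digraph" and H :: "('c, 'd) pre_digraph"
    and vs :: "'a list" and ws :: "'c list" and n :: nat and M :: matrix_kind
  assumes "graph G" and "Digraph_Component.connected G" and "card (verts G) = n"
    and "graph H" and "Digraph_Component.connected H" and "card (verts H) = n"
    and "enumerates vs G" and "enumerates ws H"
  shows "coinvariant M G vs H ws \<longleftrightarrow> codeterminantal M G vs H ws"
proof -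
  have "length vs = n" "length ws = n"
    using assms(3,6,7,8) unfolding enumerates_def by (auto simp: distinct_card[symmetric])
  then have "graph_mat M G vs \<in> carrier_mat n n" "graph_mat M H ws \<in> carrier_mat n n"
    using graph_mat_carrier[of M G vs] graph_mat_carrier[of M H ws] by simp_all
  from smith_normal_form_eq_iff_determinantal_ideal_eq[OF this] show ?thesis
    unfolding coinvariant_def codeterminantal_def assms(3) by simp
qed

end
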